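(* Let $s,n\in\mathbb{Z}_{\ge 0}$. For every $(x,y)\in\mathcal{G}_{s,n}$, $$F_s(x+1)=2y+1.$$
   Context: For $s,n\in\mathbb{Z}_{\ge 0}$ let $$\mathcal{G}_{s,n} = \{((2s+1)2^n-1+m,\,m): m\in\mathbb{Z}_{\ge 0},\ 0\le m\le (2s+1)2^n-1\}.$$ Josephus problem: for $v\ge 1$, the numbers $1,2,\dots,v$ are arranged in this order in a circle. Starting with $2$, every second remaining number is removed (that is, skip $1$, remove $2$, then repeatedly skip the next remaining number around the circle and remove the remaining number after it) until only one number is left. Let $e_1,e_2,\dots,e_{v-1}$ be the removed numbers in order of removal, and let $e_v$ be the number left at the end (for $v=1$, $e_1=1$). For $s=0,1,\dots,v-1$ define $F_s(v)=e_{v-s}$; so $F_0(v)$ is the last remaining number. *)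

theory Defs
  imports Main
begin

definition G :: "nat \<Rightarrow> nat \<Rightarrow> (nat \<times> nat) set" where
  "G s n = {((2 * s + 1) * 2 ^ n - 1 + m, m) | m. 0 \<le> m \<and> m \<le> (2 * s + 1) * 2 ^ n - 1}"

text \<open>
  A list represents the circle of remaining numbers, read off from the number that is to be
  skipped next. One step skips the head \<open>x\<close>, which thereby moves to the far end of
  the circle, and removes the number \<open>y\<close> after it. The result lists the removed
  numbers in order of removal, followed by the number left at the end.
\<close>

fun removal_order :: "'a list \<Rightarrow> 'a list" where
  "removal_order [] = []"
| "removal_order [x] = [x]"
| "removal_order (x # y # zs) = y # removal_order (zs @ [x])"

text \<open>The paper's \<open>e\<^sub>i\<close> (for \<open>v\<close> numbers), meaningful for \<open>1 \<le> i \<le> v\<close>; the list index starts at 0.\<close>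

definition e :: "nat \<Rightarrow> nat \<Rightarrow> nat" where
  "e v i = removal_order [1..<v + 1] ! (i - 1)"

text \<open>Meaningful for \<open>s < v\<close> only; see \<open>G_less\<close> below.\<close>

definition F :: "nat \<Rightarrow> nat \<Rightarrow> nat" where
  "F s v = e v (v - s)"

lemma length_removal_order: "length (removal_order xs) = length xs"
  by (induction xs rule: removal_order.induct) auto

lemma G_less:
  assumes "(x, y) \<in> G s n"
  shows "s < x + 1"
proof -
  have "2 * s + 1 \<le> (2 * s + 1) * 2 ^ n"
    using mult_le_mono2[of 1 "2 ^ n" "2 * s + 1"] by simp
  with assms show ?thesis
    unfolding G_def by auto
qed

lemma removal_order_5: "removal_order [1..<5 + 1] = [2, 4, 1, 5, 3]"
  by (simp add: upt_rec)

end

theory Submission imports Defs begin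

text \<open>
  After \<open>m\<close> removals the circle \<open>1, \<dots>, N + m\<close>, where \<open>m < N\<close>, starts at
  \<open>2 * m + 1\<close>. So it suffices that, in a circle of \<open>N = (2 * s + 1) * 2 ^ n\<close> elements,
  the first one is removed with exactly \<open>s\<close> elements left. For \<open>n = 0\<close> the first
  \<open>s\<close> removals lead to the last element, which is then skipped, and the first one is removed next;
  for larger \<open>n\<close> one full round halves the circle and returns to the first element.
\<close>

text \<open>Before any skipped element comes up again, each step skips an even index and removes the
  odd one after it, so the skipped elements gather at the back in order.\<close>

lemma removal_order_nth_add:
  assumes "2 * m \<le> length xs"
  shows "removal_order xs ! (m + i)
    = removal_order (drop (2 * m) xs @ map (\<lambda>j. xs ! (2 * j)) [0..<m]) ! i"
  using assms
proof (induction m arbitrary: xs)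
  case 0
  then show ?case by simp
next
  case (Suc m)
  then obtain x y zs where xs: "xs = x # y # zs"
    by (cases xs rule: removal_order.cases) auto
  \<comment> \<open>Here \<open>2 * j < length zs\<close>, so the appended \<open>x\<close> is never
    read.\<close>
  have "map (\<lambda>j. (zs @ [x]) ! (2 * j)) [0..<m] = map (\<lambda>j. xs ! (2 * Suc j)) [0..<m]"
    using Suc.prems by (auto simp: xs nth_append)
  then have "drop (2 * m) (zs @ [x]) @ map (\<lambda>j. (zs @ [x]) ! (2 * j)) [0..<m]
    = drop (2 * Suc m) xs @ map (\<lambda>j. xs ! (2 * j)) [0..<Suc m]"
    using Suc.prems by (simp add: xs map_upt_Suc del: upt_Suc)
  then show ?case
    using Suc.IH[of "zs @ [x]"] Suc.prems by (simp add: xs)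
qed

lemma removal_order_nth_hd:
  assumes "length xs = (2 * s + 1) * 2 ^ n"
  shows "removal_order xs ! (length xs - Suc s) = hd xs"
  using assms
proof (induction n arbitrary: xs)
  case 0
  then have len: "length xs = Suc (2 * s)" by simp
  show ?case
  \<comment> \<open>Only for \<open>s > 0\<close> has the first element been skipped to the back;
    for \<open>s = 0\<close> the circle is a singleton.\<close>
  proof (cases s)
    case 0
    with len show ?thesis by (auto simp: length_Suc_conv)
  next
    case (Suc t)
    have "drop (2 * s) xs @ map (\<lambda>j. xs ! (2 * j)) [0..<s]
      = xs ! (2 * s) # xs ! 0 # map (\<lambda>j. xs ! (2 * Suc j)) [0..<t]"
      using len by (simp add: Suc Cons_nth_drop_Suc[symmetric] map_upt_Suc del: upt_Suc)
    then have "removal_order xs ! (s + 0) = xs ! 0"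
      using removal_order_nth_add[of s xs 0] len by simp
    then show ?thesis
      using len by (simp add: hd_conv_nth flip: length_greater_0_conv)
  qed
next
  case (Suc n)
  define k where "k = (2 * s + 1) * 2 ^ n"
  define ys where "ys = map (\<lambda>j. xs ! (2 * j)) [0..<k]"
  have len: "length xs = 2 * k" using Suc.prems by (simp add: k_def)
  have "2 * s + 1 \<le> k"
    using mult_le_mono2[of 1 "2 ^ n" "2 * s + 1"] by (simp add: k_def)
  then have "s < k" by simp
  have "removal_order xs ! (length xs - Suc s) = removal_order xs ! (k + (k - Suc s))"
    using len \<open>s < k\<close> by (intro arg_cong[where f = "nth _"]) simp
  \<comment> \<open>The first \<open>k\<close> removals use up all \<open>2 * k\<close> elements, so
    the dropped part is empty and \<open>ys\<close> is the whole circle.\<close>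
  also have "\<dots> = removal_order ys ! (length ys - Suc s)"
    using removal_order_nth_add[of k xs] len by (simp add: ys_def)
  also have "\<dots> = hd ys"
    by (rule Suc.IH) (simp add: ys_def k_def)
  also have "\<dots> = hd xs"
    using len \<open>s < k\<close> by (cases xs) (auto simp: ys_def hd_map)
  finally show ?case .
qed

theorem theorem2p2:
  fixes s n x y :: nat
  assumes "(x, y) \<in> G s n"
  shows "F s (x + 1) = 2 * y + 1"
proof -
  define N where "N = (2 * s + 1) * 2 ^ n"
  have "2 * s + 1 \<le> N"
    using mult_le_mono2[of 1 "2 ^ n" "2 * s + 1"] by (simp add: N_def)
  then have "s < N" by simp
  have x: "x + 1 = N + y" and "y < N"
    using assms \<open>s < N\<close> unfolding G_def N_def[symmetric] by auto
  define xs where "xs = [1..<N + y + 1]"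
  define ys where "ys = drop (2 * y) xs @ map (\<lambda>j. xs ! (2 * j)) [0..<y]"
  have len: "length xs = N + y" by (simp add: xs_def del: upt_Suc)
  have ys: "length ys = N" using \<open>y < N\<close> len by (simp add: ys_def)
  have "F s (x + 1) = removal_order xs ! (y + (N - Suc s))"
    using \<open>s < N\<close> unfolding F_def e_def x xs_def
    by (intro arg_cong[where f = "nth _"]) simp
  also have "\<dots> = removal_order ys ! (length ys - Suc s)"
    using removal_order_nth_add[of y xs] len ys \<open>y < N\<close> by (simp add: ys_def)
  also have "\<dots> = hd ys"
    by (rule removal_order_nth_hd) (simp add: ys N_def)
  \<comment> \<open>Since \<open>2 * y < N + y\<close>, the head is \<open>xs ! (2 * y)\<close>, and
    \<open>xs\<close> counts from 1.\<close>
  also have "\<dots> = 2 * y + 1"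
    using \<open>y < N\<close> len by (simp add: ys_def hd_append hd_drop_conv_nth) (simp add: xs_def del: upt_Suc)
  finally show ?thesis .
qed

end
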